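(* Let $\lambda$ be a nonzero real number, $k\in\mathbb{Z}$, and let $Y$ be a random variable whose moment generating function $E[e^{Yt}]$ exists for $|t|<r$ for some $r>0$. Let $(Y_j)_{j\ge1}$ be mutually independent copies of $Y$, and $S_0=0$, $S_m=Y_1+\cdots+Y_m$ for $m\ge1$. For every positive integer $n$, $$\mathrm{Bel}_{n,\lambda}^{(k,Y)}(x)=\sum_{l=1}^{n}\bigg(\frac{(1)_{l,\lambda}}{(l-1)!\,l^{k}}\sum_{m=0}^{l}\binom{l}{m}(-1)^{l-m}E\big[(S_m)_{n,\lambda}\big]\bigg)x^{l},$$ and $$(1)_{l,\lambda}\sum_{m=0}^{l}\binom{l}{m}(-1)^{l-m}E\big[(S_m)_{n,\lambda}\big]=0\quad\text{for all } l\ge n+1.$$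
   Context: Degenerate falling factorial: $(x)_{0,\lambda}=1$, $(x)_{n,\lambda}=x(x-\lambda)\cdots(x-(n-1)\lambda)$ for $n\ge1$. Degenerate exponential: $e_\lambda^x(t)=(1+\lambda t)^{x/\lambda}=\sum_{n\ge0}(x)_{n,\lambda}\frac{t^n}{n!}$. For $k\in\mathbb{Z}$, $\mathrm{Ei}_{k,\lambda}(x)=\sum_{n=1}^{\infty}\frac{(1)_{n,\lambda}}{(n-1)!\,n^{k}}x^{n}$. The probabilistic degenerate poly-Bell polynomials $\mathrm{Bel}_{n,\lambda}^{(k,Y)}(x)$ are defined by $\mathrm{Ei}_{k,\lambda}\big(x(E[e_\lambda^Y(t)]-1)\big)=\sum_{n=1}^{\infty}\mathrm{Bel}_{n,\lambda}^{(k,Y)}(x)\frac{t^n}{n!}$ (power series in $t$), with $\mathrm{Bel}_{0,\lambda}^{(k,Y)}(x)=1$. *)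

theory Defs
  imports "HOL-Probability.Probability"
begin

definition degen_ffact :: "real \<Rightarrow> real \<Rightarrow> nat \<Rightarrow> real" where
  "degen_ffact lam x n = (\<Prod>i<n. x - real i * lam)"

definition degen_exp :: "real \<Rightarrow> real \<Rightarrow> real \<Rightarrow> real" where
  "degen_exp lam x t = (1 + lam * t) powr (x / lam)"

(* The sum over n \<ge> 1 is indexed by Suc n. It converges for \<bar>lam * x\<bar> < 1; values elsewhere
   are irrelevant, since only the germ at 0 enters below. *)
definition degen_Ei :: "int \<Rightarrow> real \<Rightarrow> real \<Rightarrow> real" where
  "degen_Ei k lam x =
     (\<Sum>n. degen_ffact lam 1 (Suc n) / (fact n * real (Suc n) powi k) * x ^ Suc n)"

definition poly_bell_genfun :: "'a measure \<Rightarrow> ('a \<Rightarrow> real) \<Rightarrow> real \<Rightarrow> int \<Rightarrow> real \<Rightarrow> real \<Rightarrow> real" where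
  "poly_bell_genfun M Y lam k x t =
     degen_Ei k lam (x * ((\<integral>\<omega>. degen_exp lam (Y \<omega>) t \<partial>M) - 1))"

(* A power series with positive radius of convergence is determined by its sum near 0, so
   the description below is unambiguous whenever the generating function has an expansion. *)
definition poly_bell :: "'a measure \<Rightarrow> ('a \<Rightarrow> real) \<Rightarrow> real \<Rightarrow> int \<Rightarrow> nat \<Rightarrow> real \<Rightarrow> real" where
  "poly_bell M Y lam k n x =
     (if n = 0 then 1
      else fact n * fps_nth (THE F. poly_bell_genfun M Y lam k x has_fps_expansion F) n)"

end

theory Submission
  imports Defs "HOL-Complex_Analysis.Laurent_Convergence"
begin

text \<open>
  Put \<open>u = ln (1 + \<lambda> t) / \<lambda>\<close>, so that \<open>e\<^sub>\<lambda>\<^sup>Y(t) = exp (u Y)\<close>. Near \<open>t = 0\<close> the partial sums of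
  the binomial series of \<open>e\<^sub>\<lambda>\<^sup>Y(t)\<close> are dominated by \<open>exp (v \<bar>Y\<bar>)\<close> with a small \<open>v\<close>, hence \<open>E[e\<^sub>\<lambda>\<^sup>Y(t)]\<close>
  is analytic at 0 with Taylor series \<open>F = \<Sum>\<^sub>n E[(Y)\<^sub>n\<^sub>,\<^sub>\<lambda>] t\<^sup>n / n!\<close>. The same applies to \<open>S\<^sub>m\<close>, and by
  independence its series is \<open>F\<^sup>m\<close>. The alternating sum over \<open>m\<close> is therefore \<open>n!\<close> times the \<open>n\<close>-th
  coefficient of \<open>(F - 1)\<^sup>l\<close>, which vanishes for \<open>l > n\<close> because \<open>F - 1\<close> has no constant term, and
  composing the series of \<open>Ei\<close> with \<open>x (F - 1)\<close> gives the formula.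
\<close>

section \<open>Uniqueness and composition of expansions of real functions\<close>

text \<open>A nonzero power series has isolated zeros. This determines the \<open>THE\<close> in
  \<open>poly_bell\<close> and turns identities of functions near 0 into identities of
  series.\<close>

lemma fps_expansion_unique_real:
  fixes f :: "real \<Rightarrow> real"
  assumes "f has_fps_expansion F" "f has_fps_expansion G"
  shows "F = G"
proof (rule ccontr)
  assume "F \<noteq> G"
  define D where "D = F - G"
  from \<open>F \<noteq> G\<close> obtain m where m: "fps_nth D m \<noteq> 0"
    by (auto simp: D_def fps_eq_iff)
  have D: "(\<lambda>_. 0) has_fps_expansion D"
    using has_fps_expansion_diff[OF assms] by (simp add: D_def)
  have "fps_nth D 0 = 0"
    using has_fps_expansion_imp_0_eq_fps_nth_0[OF D] by simp
  with m have "m > 0" by (metis gr0I)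
  have "eventually (\<lambda>x. x \<in> eball 0 (fps_conv_radius D)) (nhds 0)"
    using D by (intro eventually_nhds_in_open) (auto simp: has_fps_expansion_def zero_ereal_def)
  moreover have "eventually (\<lambda>x. eval_fps D x = 0) (nhds 0)"
    using D by (simp add: has_fps_expansion_def)
  ultimately have "eventually (\<lambda>x. (\<lambda>n. fps_nth D n * x ^ n) sums 0) (nhds 0)"
  proof eventually_elim
    case (elim x)
    thus ?case using sums_eval_fps[of x D] by simp
  qed
  then obtain r where "r > 0" "\<And>x. \<bar>x\<bar> < r \<Longrightarrow> (\<lambda>n. fps_nth D n * x ^ n) sums 0"
    by (auto simp: eventually_nhds_metric dist_real_def)
  \<comment> \<open>Isolation of zeros, applied to the zero function, claims that this function is
    nonzero on a punctured disc; evaluating at \<open>s\<close> itself gives the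
    contradiction.\<close>
  then obtain s :: real where s: "s > 0" "\<And>z::real. z \<in> cball 0 s - {0} \<Longrightarrow> (0::real) \<noteq> 0"
    using powser_0_nonzero[of r 0 "fps_nth D" "\<lambda>_. 0" m] m \<open>m > 0\<close> by auto
  show False using s(2)[of s] s(1) by simp
qed

text \<open>The embedding respects products and composition, and it preserves absolute values of
  coefficients, hence the radius of convergence. It serves the composition lemma
  \<open>has_fps_expansion_compose_real\<close> below.\<close>

definition fps_of_real :: "real fps \<Rightarrow> complex fps" where
  "fps_of_real F = Abs_fps (\<lambda>n. complex_of_real (fps_nth F n))"

lemma fps_nth_fps_of_real [simp]: "fps_nth (fps_of_real F) n = of_real (fps_nth F n)"
  by (simp add: fps_of_real_def)

lemma fps_conv_radius_fps_of_real [simp]: "fps_conv_radius (fps_of_real F) = fps_conv_radius F"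
  unfolding fps_conv_radius_def conv_radius_def by simp

lemma fps_of_real_mult: "fps_of_real (F * G) = fps_of_real F * fps_of_real G"
  by (simp add: fps_eq_iff fps_mult_nth)

lemma fps_of_real_power: "fps_of_real (F ^ n) = fps_of_real F ^ n"
proof (induction n)
  case 0
  show ?case by (simp add: fps_eq_iff)
qed (simp add: fps_of_real_mult)

lemma fps_of_real_compose: "fps_of_real (F oo G) = fps_of_real F oo fps_of_real G"
  by (simp add: fps_eq_iff fps_compose_nth flip: fps_of_real_power)

lemma eval_fps_fps_of_real:
  assumes "ereal \<bar>x\<bar> < fps_conv_radius F"
  shows "eval_fps (fps_of_real F) (of_real x) = of_real (eval_fps F x)"
  using sums_of_real[OF sums_eval_fps[of x F], where 'a = complex] assms
  by (simp add: eval_fps_def sums_iff)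

text \<open>Both series are continued to a complex neighbourhood of 0, composed there, and the
  composite is restricted to the reals.\<close>

lemma has_fps_expansion_compose_real:
  fixes f g :: "real \<Rightarrow> real"
  assumes F: "f has_fps_expansion F"
    and G: "g has_fps_expansion G" "fps_nth G 0 = 0"
  shows "(\<lambda>x. f (g x)) has_fps_expansion (F oo G)"
proof -
  have rF: "fps_conv_radius F > 0" and rG: "fps_conv_radius G > 0"
    using F G by (auto simp: has_fps_expansion_def)
  have "(eval_fps (fps_of_real F) \<circ> eval_fps (fps_of_real G)) has_fps_expansion
          (fps_of_real F oo fps_of_real G)"
    using rF rG G(2) by (intro has_fps_expansion_compose eval_fps_has_fps_expansion) auto
  hence exp: "(eval_fps (fps_of_real F) \<circ> eval_fps (fps_of_real G)) has_fps_expansion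
          fps_of_real (F oo G)"
    by (simp add: fps_of_real_compose)
  hence rFG: "fps_conv_radius (F oo G) > 0"
    by (simp add: has_fps_expansion_def)
  have ev: "eventually (\<lambda>x::real. x \<in> eball 0 (fps_conv_radius H)) (nhds 0)"
    if "fps_conv_radius H > 0" for H :: "real fps"
    using that by (intro eventually_nhds_in_open) (auto simp: zero_ereal_def)
  have g0: "g 0 = 0"
    using has_fps_expansion_imp_0_eq_fps_nth_0[OF G(1)] G(2) by simp
  have lim_g: "filterlim g (nhds 0) (nhds 0)"
    using isCont_tendsto_compose[OF has_fps_expansion_imp_continuous[OF G(1)] filterlim_ident] g0
    by simp
  have "eventually (\<lambda>z. eval_fps (fps_of_real (F oo G)) z =
          eval_fps (fps_of_real F) (eval_fps (fps_of_real G) z)) (nhds 0)"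
    using exp by (simp add: has_fps_expansion_def)
  moreover have "filterlim complex_of_real (nhds 0) (nhds 0)"
    using tendsto_of_real[OF filterlim_ident, of 0, where 'a = complex] by simp
  ultimately have "eventually (\<lambda>x. eval_fps (fps_of_real (F oo G)) (of_real x) =
          eval_fps (fps_of_real F) (eval_fps (fps_of_real G) (of_real x))) (nhds 0)"
    by (rule eventually_compose_filterlim)
  moreover have "eventually (\<lambda>x. eval_fps G x = g x) (nhds 0)"
    using G(1) by (simp add: has_fps_expansion_def)
  moreover have "eventually (\<lambda>x. eval_fps F (g x) = f (g x)) (nhds 0)"
    using F by (intro eventually_compose_filterlim[OF _ lim_g]) (simp add: has_fps_expansion_def)
  \<comment> \<open>The outer series is compared with its complex version at the inner value
    \<open>g x\<close>, so this point must lie in the disc of \<open>F\<close> as well.\<close>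
  moreover have "eventually (\<lambda>x. g x \<in> eball 0 (fps_conv_radius F)) (nhds 0)"
    using eventually_compose_filterlim[OF ev[OF rF] lim_g] .
  ultimately have "eventually (\<lambda>x. eval_fps (F oo G) x = f (g x)) (nhds 0)"
    using ev[OF rG] ev[OF rFG]
  proof eventually_elim
    case (elim x)
    have "complex_of_real (eval_fps (F oo G) x) = of_real (f (g x))"
      using elim by (simp add: eval_fps_fps_of_real)
    thus ?case by (simp only: of_real_eq_iff)
  qed
  with rFG show ?thesis by (simp add: has_fps_expansion_def)
qed

section \<open>The degenerate exponential and its expectation\<close>

lemma degen_exp_eq_exp:
  assumes "lam * t > -1"
  shows "degen_exp lam y t = exp (y * (ln (1 + lam * t) / lam))"
  using assms by (simp add: degen_exp_def powr_def)

text \<open>Newton's binomial series with exponent \<open>y / lam\<close> at the point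
  \<open>lam * t\<close>: pulling \<open>lam\<close> out of every factor turns the degenerate
  factorial into a binomial coefficient.\<close>

lemma degen_exp_sums:
  assumes "lam \<noteq> 0" "\<bar>lam * t\<bar> < 1"
  shows "(\<lambda>n. degen_ffact lam y n / fact n * t ^ n) sums degen_exp lam y t"
proof -
  have "degen_ffact lam y n / fact n * t ^ n = (y / lam gchoose n) * (lam * t) ^ n" for n
  proof -
    have "degen_ffact lam y n = (\<Prod>i<n. lam * (y / lam - real i))"
      unfolding degen_ffact_def using assms(1) by (intro prod.cong) (auto simp: algebra_simps)
    also have "\<dots> = lam ^ n * (\<Prod>i<n. y / lam - real i)"
      by (simp add: prod.distrib)
    finally show ?thesis
      by (simp add: gbinomial_prod_rev power_mult_distrib lessThan_atLeast0)
  qed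
  thus ?thesis
    using gen_binomial_real[OF assms(2), of "y / lam"] by (simp add: degen_exp_def)
qed

text \<open>The triangle inequality bounds each factor by
  \<open>\<bar>y\<bar> + i * \<bar>lam\<bar>\<close>. The product of these bounds is written as a
  signed degenerate factorial so that \<open>degen_exp_sums\<close> can sum the majorant
  too.\<close>

lemma abs_degen_ffact_le:
  "\<bar>degen_ffact lam y n\<bar> \<le> (-1) ^ n * degen_ffact \<bar>lam\<bar> (-\<bar>y\<bar>) n"
proof -
  have "\<bar>degen_ffact lam y n\<bar> = (\<Prod>i<n. \<bar>y - real i * lam\<bar>)"
    by (simp add: degen_ffact_def abs_prod)
  also have "\<dots> \<le> (\<Prod>i<n. \<bar>y\<bar> + real i * \<bar>lam\<bar>)"
    by (intro prod_mono) (auto intro!: order.trans[OF abs_triangle_ineq4] simp: abs_mult)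
  also have "\<dots> = (\<Prod>i<n. (-1) * (-\<bar>y\<bar> - real i * \<bar>lam\<bar>))"
    by (intro prod.cong) auto
  also have "\<dots> = (-1) ^ n * degen_ffact \<bar>lam\<bar> (-\<bar>y\<bar>) n"
    unfolding prod.distrib by (simp add: degen_ffact_def)
  finally show ?thesis .
qed

text \<open>The majorant has nonnegative terms, the sign being absorbed into
  \<open>(-\<bar>t\<bar>) ^ n\<close>, so its full sum bounds every partial sum, uniformly in
  \<open>N\<close>.\<close>

lemma sum_abs_degen_exp_le:
  assumes "lam \<noteq> 0" "\<bar>lam * t\<bar> < 1"
  shows "(\<Sum>n<N. \<bar>degen_ffact lam y n / fact n * t ^ n\<bar>) \<le>
           exp (\<bar>y\<bar> * (- ln (1 - \<bar>lam * t\<bar>) / \<bar>lam\<bar>))"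
proof -
  let ?g = "\<lambda>n. degen_ffact \<bar>lam\<bar> (-\<bar>y\<bar>) n / fact n * (-\<bar>t\<bar>) ^ n"
  have le: "\<bar>degen_ffact lam y n / fact n * t ^ n\<bar> \<le> ?g n" for n
  proof -
    have "?g n = ((-1) ^ n * degen_ffact \<bar>lam\<bar> (-\<bar>y\<bar>) n) * (\<bar>t\<bar> ^ n / fact n)"
      by (subst power_minus) simp
    moreover have "\<bar>degen_ffact lam y n / fact n * t ^ n\<bar> = \<bar>degen_ffact lam y n\<bar> * (\<bar>t\<bar> ^ n / fact n)"
      by (simp add: abs_mult power_abs)
    ultimately show ?thesis
      using mult_right_mono[OF abs_degen_ffact_le[of lam y n], of "\<bar>t\<bar> ^ n / fact n"]
      by (simp only: zero_le_power abs_ge_zero fact_ge_zero divide_nonneg_nonneg)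
  qed
  have s: "?g sums degen_exp \<bar>lam\<bar> (-\<bar>y\<bar>) (-\<bar>t\<bar>)"
    using assms by (intro degen_exp_sums) (auto simp: abs_mult)
  have "(\<Sum>n<N. \<bar>degen_ffact lam y n / fact n * t ^ n\<bar>) \<le> (\<Sum>n<N. ?g n)"
    by (intro sum_mono le)
  also have "\<dots> \<le> degen_exp \<bar>lam\<bar> (-\<bar>y\<bar>) (-\<bar>t\<bar>)"
    unfolding sums_unique[OF s]
    by (intro sum_le_suminf sums_summable[OF s] ballI order.trans[OF abs_ge_zero le]) auto
  also have "\<dots> = exp (\<bar>y\<bar> * (- ln (1 - \<bar>lam * t\<bar>) / \<bar>lam\<bar>))"
    using assms by (subst degen_exp_eq_exp) (auto simp: abs_mult)
  finally show ?thesis .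
qed

lemma degen_exp_integral_sums:
  fixes Z :: "'a \<Rightarrow> real"
  assumes [measurable]: "Z \<in> borel_measurable M"
    and lam: "lam \<noteq> 0" and t: "\<bar>lam * t\<bar> < 1"
    and u: "- ln (1 - \<bar>lam * t\<bar>) / \<bar>lam\<bar> < r"
    and int: "\<And>t. \<bar>t\<bar> < r \<Longrightarrow> integrable M (\<lambda>\<omega>. exp (Z \<omega> * t))"
  shows "(\<lambda>n. (\<integral>\<omega>. degen_ffact lam (Z \<omega>) n \<partial>M) / fact n * t ^ n) sums
           (\<integral>\<omega>. degen_exp lam (Z \<omega>) t \<partial>M)"
proof -
  define u where "u = - ln (1 - \<bar>lam * t\<bar>) / \<bar>lam\<bar>"
  define c where "c = (\<lambda>n \<omega>. degen_ffact lam (Z \<omega>) n / fact n * t ^ n)"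
  \<comment> \<open>Whatever the sign of \<open>Z\<close>, one of the two summands equals
    \<open>exp (\<bar>Z\<bar> * u)\<close>; both are integrable because \<open>u\<close> and
    \<open>-u\<close> lie in the range of the moment generating function.\<close>
  define w where "w = (\<lambda>\<omega>. exp (Z \<omega> * u) + exp (Z \<omega> * (-u)))"
  have "u \<ge> 0" using t lam by (simp add: u_def divide_nonpos_pos)
  hence "\<bar>u\<bar> < r" using assms(4) unfolding u_def by linarith
  hence w: "integrable M w"
    unfolding w_def by (intro Bochner_Integration.integrable_add int) auto
  have [measurable]: "c n \<in> borel_measurable M" for n
    unfolding c_def degen_ffact_def by measurable
  have le: "(\<Sum>n<N. \<bar>c n \<omega>\<bar>) \<le> w \<omega>" for N \<omega>
  proof -
    have "(\<Sum>n<N. \<bar>c n \<omega>\<bar>) \<le> exp (\<bar>Z \<omega>\<bar> * u)"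
      unfolding c_def u_def by (rule sum_abs_degen_exp_le[OF lam t])
    also have "\<dots> \<le> w \<omega>" by (cases "Z \<omega> \<ge> 0") (auto simp: w_def)
    finally show ?thesis .
  qed
  have int_c: "integrable M (c n)" for n
  proof (rule Bochner_Integration.integrable_bound[OF w])
    \<comment> \<open>A single term is bounded by the sum of absolute values that ends with
      it.\<close>
    have "\<bar>c n \<omega>\<bar> \<le> w \<omega>" for \<omega>
      using le[of \<omega> "Suc n"] by (simp add: sum_nonneg order.trans[rotated])
    thus "AE \<omega> in M. norm (c n \<omega>) \<le> norm (w \<omega>)"
      by (auto simp: w_def)
  qed simp
  have "(\<lambda>N. \<integral>\<omega>. (\<Sum>n<N. c n \<omega>) \<partial>M) \<longlonglongrightarrow> (\<integral>\<omega>. degen_exp lam (Z \<omega>) t \<partial>M)"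
  proof (rule integral_dominated_convergence[OF _ _ w])
    show "(\<lambda>\<omega>. degen_exp lam (Z \<omega>) t) \<in> borel_measurable M"
      unfolding degen_exp_def by measurable
    show "AE \<omega> in M. (\<lambda>N. \<Sum>n<N. c n \<omega>) \<longlonglongrightarrow> degen_exp lam (Z \<omega>) t"
      using degen_exp_sums[OF lam t] unfolding sums_def c_def by simp
    show "AE \<omega> in M. norm (\<Sum>n<N. c n \<omega>) \<le> w \<omega>" for N
      using le[of _ N] by (auto intro: order.trans[OF sum_abs])
  qed measurable
  also have "(\<lambda>N. \<integral>\<omega>. (\<Sum>n<N. c n \<omega>) \<partial>M) = (\<lambda>N. \<Sum>n<N. \<integral>\<omega>. c n \<omega> \<partial>M)"
    using int_c by (simp add: Bochner_Integration.integral_sum)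
  also have "(\<lambda>n. \<integral>\<omega>. c n \<omega> \<partial>M) = (\<lambda>n. (\<integral>\<omega>. degen_ffact lam (Z \<omega>) n \<partial>M) / fact n * t ^ n)"
    by (simp add: c_def)
  finally show ?thesis by (simp add: sums_def)
qed

text \<open>Both smallness conditions of \<open>degen_exp_integral_sums\<close> hold near 0, since
  their left-hand sides are continuous and vanish at 0. The variable \<open>Z\<close> is general
  because both \<open>Y\<close> and the sums of its copies are inserted.\<close>

lemma degen_exp_integral_has_fps_expansion:
  fixes Z :: "'a \<Rightarrow> real"
  assumes "Z \<in> borel_measurable M" "lam \<noteq> 0" "r > 0"
    and "\<And>t. \<bar>t\<bar> < r \<Longrightarrow> integrable M (\<lambda>\<omega>. exp (Z \<omega> * t))"
  shows "(\<lambda>t. \<integral>\<omega>. degen_exp lam (Z \<omega>) t \<partial>M) has_fps_expansion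
           Abs_fps (\<lambda>n. (\<integral>\<omega>. degen_ffact lam (Z \<omega>) n \<partial>M) / fact n)"
proof (rule has_fps_expansionI)
  have "isCont (\<lambda>t. \<bar>lam * t\<bar>) 0" "isCont (\<lambda>t. - ln (1 - \<bar>lam * t\<bar>) / \<bar>lam\<bar>) 0"
    using assms(2) by (auto intro!: continuous_intros)
  from this[THEN isCont_tendsto_compose, OF filterlim_ident]
  have lim: "((\<lambda>t. \<bar>lam * t\<bar>) \<longlongrightarrow> 0) (nhds 0)"
    "((\<lambda>t. - ln (1 - \<bar>lam * t\<bar>) / \<bar>lam\<bar>) \<longlongrightarrow> 0) (nhds 0)"
    by simp_all
  have "eventually (\<lambda>t. \<bar>lam * t\<bar> < 1) (nhds 0)"
    "eventually (\<lambda>t. - ln (1 - \<bar>lam * t\<bar>) / \<bar>lam\<bar> < r) (nhds 0)"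
    using order_tendstoD(2)[OF lim(1)] order_tendstoD(2)[OF lim(2) \<open>r > 0\<close>] by auto
  thus "\<forall>\<^sub>F t in nhds 0.
      (\<lambda>n. fps_nth (Abs_fps (\<lambda>n. (\<integral>\<omega>. degen_ffact lam (Z \<omega>) n \<partial>M) / fact n)) n * t ^ n)
      sums (\<integral>\<omega>. degen_exp lam (Z \<omega>) t \<partial>M)"
  proof eventually_elim
    case (elim t)
    show ?case
      using degen_exp_integral_sums[OF assms(1,2) elim assms(4)] by simp
  qed
qed

section \<open>Sums of independent copies\<close>

context prob_space
begin

text \<open>The exponential of the sum is a product of independent variables, and integrability and
  expectation of each factor depend only on its distribution. For \<open>m = 0\<close> both sides of
  the identity are 1.\<close>

lemma iid_sum_mgf:
  fixes Y :: "'a \<Rightarrow> real" and Ys :: "nat \<Rightarrow> 'a \<Rightarrow> real"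
  assumes Y [measurable]: "random_variable borel Y"
    and int: "integrable M (\<lambda>\<omega>. exp (Y \<omega> * t))"
    and indep: "indep_vars (\<lambda>_. borel) Ys {1..}"
    and distr: "\<And>j. j \<ge> 1 \<Longrightarrow> distr M borel (Ys j) = distr M borel Y"
  shows "integrable M (\<lambda>\<omega>. exp ((\<Sum>j=1..m. Ys j \<omega>) * t))"
    and "expectation (\<lambda>\<omega>. exp ((\<Sum>j=1..m. Ys j \<omega>) * t)) = expectation (\<lambda>\<omega>. exp (Y \<omega> * t)) ^ m"
proof -
  have rv: "random_variable borel (Ys j)" if "j \<in> {1..m}" for j
    using indep that by (auto simp: indep_vars_def)
  have ind: "indep_vars (\<lambda>_. borel) (\<lambda>j \<omega>. exp (Ys j \<omega> * t)) {1..m}"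
    using indep_vars_subset[OF indep, of "{1..m}"] by (rule indep_vars_compose2) auto
  have intj: "integrable M (\<lambda>\<omega>. exp (Ys j \<omega> * t))" if "j \<in> {1..m}" for j
  proof -
    have "integrable (distr M borel Y) (\<lambda>y. exp (y * t))"
      using int by (subst integrable_distr_eq) auto
    hence "integrable (distr M borel (Ys j)) (\<lambda>y. exp (y * t))"
      using distr[of j] that by simp
    thus ?thesis using rv[OF that] by (subst (asm) integrable_distr_eq) auto
  qed
  have eqj: "expectation (\<lambda>\<omega>. exp (Ys j \<omega> * t)) = expectation (\<lambda>\<omega>. exp (Y \<omega> * t))"
    if "j \<in> {1..m}" for j
    using integral_distr[OF rv[OF that], of "\<lambda>y. exp (y * t)"]
      integral_distr[OF Y, of "\<lambda>y. exp (y * t)"] distr[of j] that by simp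
  have exp_eq: "exp ((\<Sum>j=1..m. Ys j \<omega>) * t) = (\<Prod>j\<in>{1..m}. exp (Ys j \<omega> * t))" for \<omega>
    by (simp add: sum_distrib_right exp_sum)
  show "integrable M (\<lambda>\<omega>. exp ((\<Sum>j=1..m. Ys j \<omega>) * t))"
    unfolding exp_eq using ind intj by (intro indep_vars_integrable) auto
  show "expectation (\<lambda>\<omega>. exp ((\<Sum>j=1..m. Ys j \<omega>) * t)) = expectation (\<lambda>\<omega>. exp (Y \<omega> * t)) ^ m"
    unfolding exp_eq using ind intj eqj by (subst indep_vars_lebesgue_integral) auto
qed

text \<open>Both series expand the same function near 0, so no comparison of individual moments is
  made.\<close>

lemma fps_power_degen_moments_iid:
  fixes Y :: "'a \<Rightarrow> real" and Ys :: "nat \<Rightarrow> 'a \<Rightarrow> real"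
  assumes Y [measurable]: "random_variable borel Y"
    and lam: "lam \<noteq> 0" and r: "r > 0"
    and int: "\<And>t. \<bar>t\<bar> < r \<Longrightarrow> integrable M (\<lambda>\<omega>. exp (Y \<omega> * t))"
    and indep: "indep_vars (\<lambda>_. borel) Ys {1..}"
    and distr: "\<And>j. j \<ge> 1 \<Longrightarrow> distr M borel (Ys j) = distr M borel Y"
  shows "Abs_fps (\<lambda>n. expectation (\<lambda>\<omega>. degen_ffact lam (Y \<omega>) n) / fact n) ^ m =
         Abs_fps (\<lambda>n. expectation (\<lambda>\<omega>. degen_ffact lam (\<Sum>j=1..m. Ys j \<omega>) n) / fact n)"
    (is "?F ^ m = ?G")
proof (rule fps_expansion_unique_real)
  let ?S = "\<lambda>\<omega>. \<Sum>j=1..m. Ys j \<omega>"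
  have rv: "random_variable borel (Ys j)" if "j \<in> {1..m}" for j
    using indep that by (auto simp: indep_vars_def)
  show "(\<lambda>t. expectation (\<lambda>\<omega>. degen_exp lam (Y \<omega>) t) ^ m) has_fps_expansion ?F ^ m"
    by (intro has_fps_expansion_power degen_exp_integral_has_fps_expansion[OF Y lam r int])
  have "(\<lambda>t. expectation (\<lambda>\<omega>. degen_exp lam (?S \<omega>) t)) has_fps_expansion ?G"
    using rv iid_sum_mgf(1)[OF Y int indep distr]
    by (intro degen_exp_integral_has_fps_expansion[OF _ lam r]) auto
  also have "?this \<longleftrightarrow> (\<lambda>t. expectation (\<lambda>\<omega>. degen_exp lam (Y \<omega>) t) ^ m) has_fps_expansion ?G"
  proof (rule has_fps_expansion_cong)
    have "isCont (\<lambda>t. \<bar>ln (1 + lam * t) / lam\<bar>) 0" "isCont (\<lambda>t. lam * t) 0"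
      using lam by (auto intro!: continuous_intros)
    from this[THEN isCont_tendsto_compose, OF filterlim_ident]
    have lim: "((\<lambda>t. \<bar>ln (1 + lam * t) / lam\<bar>) \<longlongrightarrow> 0) (nhds 0)" "((\<lambda>t. lam * t) \<longlongrightarrow> 0) (nhds 0)"
      by simp_all
    \<comment> \<open>The first condition allows the moment generating function to be taken at
      \<open>ln (1 + lam * t) / lam\<close>; the second lets \<open>degen_exp\<close> be rewritten
      as an ordinary exponential at that point.\<close>
    have "eventually (\<lambda>t. \<bar>ln (1 + lam * t) / lam\<bar> < r) (nhds 0)"
      "eventually (\<lambda>t. lam * t > -1) (nhds 0)"
      using order_tendstoD(2)[OF lim(1) r] order_tendstoD(1)[OF lim(2), of "-1"] by auto
    thus "\<forall>\<^sub>F t in nhds 0. expectation (\<lambda>\<omega>. degen_exp lam (?S \<omega>) t) =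
            expectation (\<lambda>\<omega>. degen_exp lam (Y \<omega>) t) ^ m"
    proof eventually_elim
      case (elim t)
      show ?case
        using iid_sum_mgf(2)[OF Y int[OF elim(1)] indep distr]
        by (simp only: degen_exp_eq_exp[OF elim(2)])
    qed
  qed simp
  finally show "(\<lambda>t. expectation (\<lambda>\<omega>. degen_exp lam (Y \<omega>) t) ^ m) has_fps_expansion ?G" .
qed

end

section \<open>The power series of the degenerate polyexponential function\<close>

text \<open>The constant coefficient is set by hand: for \<open>k = 0\<close> the general formula
  would give 1 at \<open>l = 0\<close>, since \<open>0 - 1 = 0\<close> in the naturals and
  \<open>0 powi 0 = 1\<close>.\<close>

definition degen_Ei_fps :: "int \<Rightarrow> real \<Rightarrow> real fps" where
  "degen_Ei_fps k lam =
     Abs_fps (\<lambda>l. if l = 0 then 0 else degen_ffact lam 1 l / (fact (l - 1) * real l powi k))"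

lemma abs_degen_ffact_1_le: "\<bar>degen_ffact lam 1 n\<bar> \<le> (1 + \<bar>lam\<bar>) ^ n * fact n"
proof -
  have "\<bar>1 - real i * lam\<bar> \<le> (1 + \<bar>lam\<bar>) * real (Suc i)" for i
  proof -
    have "\<bar>1 - real i * lam\<bar> \<le> 1 + real i * \<bar>lam\<bar>"
      by (rule order.trans[OF abs_triangle_ineq4]) (simp add: abs_mult)
    also have "\<dots> \<le> (1 + \<bar>lam\<bar>) * real (Suc i)" by (simp add: algebra_simps)
    finally show ?thesis .
  qed
  hence "\<bar>degen_ffact lam 1 n\<bar> \<le> (\<Prod>i<n. (1 + \<bar>lam\<bar>) * real (Suc i))"
    unfolding degen_ffact_def abs_prod by (intro prod_mono) auto
  also have "\<dots> = (1 + \<bar>lam\<bar>) ^ n * fact n"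
    unfolding prod.distrib by (simp add: fact_prod_Suc lessThan_atLeast0)
  finally show ?thesis .
qed

text \<open>The coefficients are at most a geometric factor times a power of \<open>n\<close>, and
  \<open>n < 2 ^ n\<close> makes that power geometric too. Only a positive radius is sought, so the
  estimates are crude.\<close>

lemma degen_Ei_fps_conv_radius_pos: "fps_conv_radius (degen_Ei_fps k lam) > 0"
proof -
  \<comment> \<open>One power of \<open>n\<close> comes from \<open>fact n / fact (n - 1)\<close>,
    the other \<open>\<bar>k\<bar>\<close> from \<open>1 / n powi k\<close>; the point
    \<open>z\<close> is chosen to make the final geometric ratio 1/2.\<close>
  define p where "p = Suc (nat \<bar>k\<bar>)"
  define z where "z = inverse (2 * 2 ^ p * (1 + \<bar>lam\<bar>))"
  have z: "z > 0" "2 ^ p * ((1 + \<bar>lam\<bar>) * z) = 1/2" 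
    by (simp_all add: z_def add_pos_nonneg add_nonneg_eq_0_iff divide_simps)
  have le: "norm (fps_nth (degen_Ei_fps k lam) n * z ^ n) \<le> (1/2) ^ n" for n
  proof (cases "n = 0")
    case False
    have "inverse (real n powi k) = real n powi (-k)"
      by (simp add: power_int_minus)
    also have "\<dots> \<le> real n powi (int (nat \<bar>k\<bar>))"
      using False by (intro power_int_increasing) auto
    finally have 1: "inverse (real n powi k) \<le> real n ^ nat \<bar>k\<bar>"
      by (simp only: power_int_of_nat)
    have 2: "\<bar>degen_ffact lam 1 n\<bar> / fact (n - 1) \<le> (1 + \<bar>lam\<bar>) ^ n * real n"
      using abs_degen_ffact_1_le[of lam n] False
      by (cases n) (auto simp: divide_simps algebra_simps)
    have "norm (fps_nth (degen_Ei_fps k lam) n * z ^ n) =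
            (\<bar>degen_ffact lam 1 n\<bar> / fact (n - 1)) * inverse (real n powi k) * z ^ n"
      using False z(1) by (simp add: degen_Ei_fps_def abs_mult field_simps)
    also have "\<dots> \<le> ((1 + \<bar>lam\<bar>) ^ n * real n) * real n ^ nat \<bar>k\<bar> * z ^ n"
      using z(1) by (intro mult_right_mono mult_mono 1 2) auto
    also have "\<dots> = real n ^ p * ((1 + \<bar>lam\<bar>) * z) ^ n"
      by (simp add: p_def power_mult_distrib mult_ac)
    also have "\<dots> \<le> (2 ^ n) ^ p * ((1 + \<bar>lam\<bar>) * z) ^ n"
      using z(1) of_nat_less_two_power[of n, where 'a = real]
      by (intro mult_right_mono power_mono) auto
    also have "\<dots> = (2 ^ p * ((1 + \<bar>lam\<bar>) * z)) ^ n"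
      by (simp add: power_mult_distrib mult.commute flip: power_mult)
    finally show ?thesis by (simp only: z(2))
  qed (simp add: degen_Ei_fps_def)
  have "summable (\<lambda>n. fps_nth (degen_Ei_fps k lam) n * z ^ n)"
    by (rule summable_comparison_test'[OF summable_geometric le]) simp
  from conv_radius_geI[OF this] have "ereal z \<le> fps_conv_radius (degen_Ei_fps k lam)"
    using z(1) by (simp add: fps_conv_radius_def)
  moreover have "0 < ereal z" using z(1) by simp
  ultimately show ?thesis by (rule less_le_trans[rotated])
qed

lemma degen_Ei_has_fps_expansion: "degen_Ei k lam has_fps_expansion degen_Ei_fps k lam"
proof -
  define R where "R = fps_conv_radius (degen_Ei_fps k lam)"
  have "R > 0" using degen_Ei_fps_conv_radius_pos by (simp add: R_def)
  hence "eventually (\<lambda>x::real. x \<in> eball 0 R) (nhds 0)"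
    by (intro eventually_nhds_in_open) (auto simp: zero_ereal_def)
  hence "eventually (\<lambda>x. eval_fps (degen_Ei_fps k lam) x = degen_Ei k lam x) (nhds 0)"
  proof eventually_elim
    case (elim x)
    have "(\<lambda>n. fps_nth (degen_Ei_fps k lam) n * x ^ n) sums eval_fps (degen_Ei_fps k lam) x"
      using elim by (intro sums_eval_fps) (simp add: R_def)
    \<comment> \<open>The sum in \<open>degen_Ei\<close> starts at exponent 1; the zero constant
      coefficient lets the index shift without changing the value.\<close>
    hence "(\<lambda>n. fps_nth (degen_Ei_fps k lam) (Suc n) * x ^ Suc n) sums eval_fps (degen_Ei_fps k lam) x"
      by (subst sums_Suc_iff) (simp add: degen_Ei_fps_def)
    thus ?case
      by (simp add: degen_Ei_def degen_Ei_fps_def sums_iff del: of_nat_Suc power_Suc)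
  qed
  with degen_Ei_fps_conv_radius_pos show ?thesis by (simp add: has_fps_expansion_def)
qed

section \<open>Extraction of coefficients\<close>

theorem theorem2p3:
  fixes M :: "'a measure" and Y :: "'a \<Rightarrow> real" and Ys :: "nat \<Rightarrow> 'a \<Rightarrow> real"
    and S :: "nat \<Rightarrow> 'a \<Rightarrow> real" and lam r :: real and k :: int and n :: nat
  assumes "prob_space M"
    and "lam \<noteq> 0"
    and "Y \<in> borel_measurable M"
    and "r > 0"
    and "\<And>t. \<bar>t\<bar> < r \<Longrightarrow> integrable M (\<lambda>\<omega>. exp (Y \<omega> * t))"
    and "prob_space.indep_vars M (\<lambda>_. borel) Ys {1..}"
    and "\<And>j. j \<ge> 1 \<Longrightarrow> distr M borel (Ys j) = distr M borel Y"
    and "\<And>m \<omega>. S m \<omega> = (\<Sum>j=1..m. Ys j \<omega>)"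
    and "n \<ge> 1"
  shows "(\<forall>x::real. poly_bell M Y lam k n x =
           (\<Sum>l=1..n. degen_ffact lam 1 l / (fact (l - 1) * real l powi k) *
              (\<Sum>m=0..l. real (l choose m) * (-1) ^ (l - m) *
                 (\<integral>\<omega>. degen_ffact lam (S m \<omega>) n \<partial>M)) * x ^ l)) \<and>
         (\<forall>l\<ge>n + 1. degen_ffact lam 1 l *
            (\<Sum>m=0..l. real (l choose m) * (-1) ^ (l - m) *
               (\<integral>\<omega>. degen_ffact lam (S m \<omega>) n \<partial>M)) = 0)"
proof -
  interpret prob_space M by fact
  define F where "F = Abs_fps (\<lambda>n. expectation (\<lambda>\<omega>. degen_ffact lam (Y \<omega>) n) / fact n)"
  define T where "T = (\<lambda>l. \<Sum>m=0..l. real (l choose m) * (-1) ^ (l - m) *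
                 (\<integral>\<omega>. degen_ffact lam (S m \<omega>) n \<partial>M))"
  have F: "(\<lambda>t. expectation (\<lambda>\<omega>. degen_exp lam (Y \<omega>) t)) has_fps_expansion F"
    unfolding F_def using assms(3,2,4,5) by (rule degen_exp_integral_has_fps_expansion)
  \<comment> \<open>The zeroth degenerate factorial is the empty product, and a probability measure
    has total mass 1.\<close>
  have F0: "fps_nth (F - 1) 0 = 0"
    by (simp add: F_def degen_ffact_def prob_space)
  have F_power: "fps_nth (F ^ m) n = expectation (\<lambda>\<omega>. degen_ffact lam (S m \<omega>) n) / fact n" for m
    unfolding F_def assms(8)
    by (subst fps_power_degen_moments_iid[OF assms(3,2,4,5,6,7)]) auto
  have T: "T l = fact n * fps_nth ((F - 1) ^ l) n" for l
  proof -
    have "(F - 1) ^ l = (\<Sum>m\<le>l. of_nat (l choose m) * F ^ m * (-1) ^ (l - m))"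
      using binomial_ring[of F "-1" l] by simp
    \<comment> \<open>Numerical factors are collected into constant series, so that taking the
      \<open>n\<close>-th coefficient becomes linear in the powers of \<open>F\<close>.\<close>
    also have "\<dots> = (\<Sum>m\<le>l. fps_const (real (l choose m) * (-1) ^ (l - m)) * F ^ m)"
      by (intro sum.cong refl)
         (simp add: fps_of_nat mult_ac flip: fps_const_mult fps_const_power fps_const_neg)
    finally show ?thesis
      by (simp add: T_def fps_sum_nth F_power sum_distrib_left atLeast0AtMost mult_ac)
  qed
  have "poly_bell M Y lam k n x =
      (\<Sum>l=1..n. degen_ffact lam 1 l / (fact (l - 1) * real l powi k) * T l * x ^ l)" for x
  proof -
    define P where "P = degen_Ei_fps k lam oo (fps_const x * (F - 1))"
    have P: "poly_bell_genfun M Y lam k x has_fps_expansion P"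
      unfolding poly_bell_genfun_def [abs_def] P_def using F0
      by (intro has_fps_expansion_compose_real degen_Ei_has_fps_expansion
            has_fps_expansion_cmult_left has_fps_expansion_diff F has_fps_expansion_1) auto
    hence "(THE F. poly_bell_genfun M Y lam k x has_fps_expansion F) = P"
      by (blast intro: fps_expansion_unique_real)
    hence "poly_bell M Y lam k n x = fact n * fps_nth P n"
      using assms(9) by (simp add: poly_bell_def)
    \<comment> \<open>The \<open>n\<close>-th coefficient of a composite involves only the powers
      \<open>l \<le> n\<close> of the inner series, which is why a polynomial in \<open>x\<close>
      results; \<open>x ^ l\<close> comes from the scaling of \<open>F - 1\<close>.\<close>
    also have "\<dots> = (\<Sum>l=0..n. fps_nth (degen_Ei_fps k lam) l * T l * x ^ l)"
      by (simp add: P_def fps_compose_nth power_mult_distrib fps_const_power T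
            sum_distrib_left mult_ac)
    also have "\<dots> = (\<Sum>l=1..n. fps_nth (degen_Ei_fps k lam) l * T l * x ^ l)"
      by (rule sum.mono_neutral_right) (auto simp: degen_Ei_fps_def not_less_eq_eq)
    also have "\<dots> = (\<Sum>l=1..n. degen_ffact lam 1 l / (fact (l - 1) * real l powi k) * T l * x ^ l)"
      by (intro sum.cong) (auto simp: degen_Ei_fps_def)
    finally show ?thesis .
  qed
  moreover have "T l = 0" if "l \<ge> n + 1" for l
    \<comment> \<open>The \<open>l\<close>-th power of a series without constant term has no
      coefficients below index \<open>l\<close>.\<close>
    using startsby_zero_power_prefix[OF F0, of l] that by (simp add: T)
  ultimately show ?thesis by (simp add: T_def)
qed

end
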